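(* Let $(\lambda_t)_{t\ge0}$ be a (real-valued) Lévy process with characteristic exponent $\psi_\lambda$, and for $0\le s\le t$ let $\Lambda_{s,t}:=\int_s^t\lambda_u\,du$. Then the log-characteristic function of $\Lambda_{s,t}$, conditional upon $\lambda_s$, is $$\psi_{\Lambda_{s,t}}(x)=ix\lambda_s(t-s)+\int_s^t\psi_\lambda\bigl(x(t-u)\bigr)\,du,\qquad x\in\mathbb{R}.$$
   Context: The characteristic exponent $\psi_\lambda$ satisfies $\mathbb{E}[e^{ix\lambda_t}]=e^{t\psi_\lambda(x)}$ for all $t\ge0$, $x\in\mathbb{R}$. The conditional log-characteristic function is $\psi_{\Lambda_{s,t}}(x)=\ln\mathbb{E}[e^{ix\Lambda_{s,t}}\mid\lambda_s]$, with the continuous branch of the logarithm vanishing at $x=0$. *)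

theory Defs
  imports "HOL-Probability.Probability"
begin

definition cadlag :: "(real \<Rightarrow> real) \<Rightarrow> bool" where
  "cadlag f \<longleftrightarrow>
     (\<forall>t\<ge>0. (f \<longlongrightarrow> f t) (at_right t)) \<and>
     (\<forall>t>0. \<exists>l. (f \<longlongrightarrow> l) (at_left t))"

text \<open>
  The time set is the half-line of nonnegative reals; values of the process at negative times
  are never referred to. The paths are required to be cadlag everywhere on the sample space, so
  that pathwise time integrals are random variables without completing the measure.
\<close>

locale levy_process = prob_space M for M :: "'a measure" +
  fixes X :: "real \<Rightarrow> 'a \<Rightarrow> real"
  assumes random_variable: "\<And>t. 0 \<le> t \<Longrightarrow> X t \<in> borel_measurable M"
    and starts_at_zero: "AE \<omega> in M. X 0 \<omega> = 0"
    and independent_increments: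
      "\<And>(n::nat) (\<tau>::nat \<Rightarrow> real). 0 \<le> \<tau> 0 \<Longrightarrow> (\<And>i. i < n \<Longrightarrow> \<tau> i < \<tau> (Suc i)) \<Longrightarrow>
         indep_vars (\<lambda>_. borel) (\<lambda>i \<omega>. X (\<tau> (Suc i)) \<omega> - X (\<tau> i) \<omega>) {..<n}"
    and stationary_increments:
      "\<And>s h. 0 \<le> s \<Longrightarrow> 0 \<le> h \<Longrightarrow>
         distr M borel (\<lambda>\<omega>. X (s + h) \<omega> - X s \<omega>) = distr M borel (X h)"
    and stochastically_continuous:
      "\<And>t \<epsilon>. 0 \<le> t \<Longrightarrow> 0 < \<epsilon> \<Longrightarrow>
         ((\<lambda>u. prob {\<omega> \<in> space M. \<epsilon> < \<bar>X u \<omega> - X t \<omega>\<bar>}) \<longlongrightarrow> 0) (at t within {0..})"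
    and cadlag_paths: "\<And>\<omega>. \<omega> \<in> space M \<Longrightarrow> cadlag (\<lambda>t. X t \<omega>)"

definition characteristic_exponent ::
    "'a measure \<Rightarrow> (real \<Rightarrow> 'a \<Rightarrow> real) \<Rightarrow> (real \<Rightarrow> complex) \<Rightarrow> bool" where
  "characteristic_exponent M X \<psi> \<longleftrightarrow>
     (\<forall>t\<ge>0. \<forall>x. char (distr M borel (X t)) x = exp (of_real t * \<psi> x))"

definition time_integral ::
    "(real \<Rightarrow> 'a \<Rightarrow> real) \<Rightarrow> real \<Rightarrow> real \<Rightarrow> 'a \<Rightarrow> real" where
  "time_integral X s t \<omega> = (LBINT u:{s..t}. X u \<omega>)"

definition sigma_gen :: "'a measure \<Rightarrow> ('a \<Rightarrow> real) \<Rightarrow> 'a measure" where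
  "sigma_gen M Y = vimage_algebra (space M) Y borel"

definition complex_cond_exp ::
    "'a measure \<Rightarrow> 'a measure \<Rightarrow> ('a \<Rightarrow> complex) \<Rightarrow> 'a \<Rightarrow> complex" where
  "complex_cond_exp M F f \<omega> =
     Complex (real_cond_exp M F (\<lambda>\<omega>. Re (f \<omega>)) \<omega>) (real_cond_exp M F (\<lambda>\<omega>. Im (f \<omega>)) \<omega>)"

text \<open>
  A conditional expectation is determined only up to a null set depending on \<open>x\<close>, so
  \<open>ln \<EE>[exp (\<i> x Y) | F]\<close>, with the continuous branch vanishing at \<open>x = 0\<close>, is a relation between
  \<open>Y\<close> and a random function \<open>\<Psi>\<close>: almost every path of \<open>\<Psi>\<close> is continuous in \<open>x\<close> and vanishes at
  \<open>0\<close>, and for each \<open>x\<close> the random variable \<open>exp (\<Psi> x)\<close> is a version of the conditional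
  expectation.
\<close>

definition cond_log_char ::
    "'a measure \<Rightarrow> 'a measure \<Rightarrow> ('a \<Rightarrow> real) \<Rightarrow> ('a \<Rightarrow> real \<Rightarrow> complex) \<Rightarrow> bool" where
  "cond_log_char M F Y \<Psi> \<longleftrightarrow>
     (AE \<omega> in M. continuous_on UNIV (\<Psi> \<omega>) \<and> \<Psi> \<omega> 0 = 0) \<and>
     (\<forall>x. AE \<omega> in M. exp (\<Psi> \<omega> x) = complex_cond_exp M F (\<lambda>\<omega>. iexp (x * Y \<omega>)) \<omega>)"

end

theory Submission
  imports Defs
begin

text \<open>
  A right-endpoint Riemann sum of \<open>L\<close> over \<open>[s, t]\<close> with mesh \<open>h\<close> is \<open>(t - s) L\<^sub>s\<close> plus a linear
  combination of the increments of \<open>L\<close> after time \<open>s\<close>, in which the increments receive the weights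
  \<open>n h, \<dots>, 2 h, h\<close>. These increments are independent of each other and of
  \<open>L\<^sub>s\<close>, so the characteristic function of the combination is
  \<open>exp (\<Sum>k<n. h \<psi> (x (k + 1) h))\<close>, itself the exponential of a Riemann sum. Cadlag paths
  are bounded and right-continuous and \<open>\<psi>\<close> is continuous, so both sums converge, and dominated
  convergence gives the conditional expectation. Uniqueness holds because a continuous logarithm
  vanishing at \<open>0\<close> is determined by its exponential on the rationals.
\<close>

section \<open>Right-endpoint Riemann sums of right-continuous functions\<close>

text \<open>The filter \<open>at_right u\<close> is punctured, whereas the sequence may take the
  value \<open>u\<close>; passing to \<open>{u..}\<close> accommodates this.\<close>

lemma right_continuous_sequentially:
  fixes f :: "real \<Rightarrow> 'b::metric_space"
  assumes "(f \<longlongrightarrow> f u) (at_right u)" and "v \<longlonglongrightarrow> u" and "\<And>n. u \<le> v n"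
  shows "(\<lambda>n. f (v n)) \<longlonglongrightarrow> f u"
proof -
  have "(f \<longlongrightarrow> f u) (at u within {u..})"
    using assms(1) by (simp add: at_within_Ici_at_right)
  then have "continuous (at u within {u..}) f"
    by (simp add: continuous_within)
  then show ?thesis
    unfolding continuous_within_sequentially using assms(2,3) by (auto simp: comp_def)
qed

text \<open>The sum is the integral of the step function \<open>S n\<close>, whose value at
  \<open>u\<close> is that of \<open>f\<close> at the right end of the cell containing
  \<open>u\<close>. This end tends to \<open>u\<close> from the right, so right continuity gives
  pointwise convergence, and boundedness gives the domination.\<close>

lemma right_riemann_sums_tendsto:
  fixes f :: "real \<Rightarrow> 'b::{banach, second_countable_topology}"
  assumes "a \<le> b" and bdd: "bounded (f ` {a..b})"
    and rc: "\<And>u. a \<le> u \<Longrightarrow> u < b \<Longrightarrow> (f \<longlongrightarrow> f u) (at_right u)"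
  shows "(\<lambda>n. \<Sum>k<n. ((b - a) / n) *\<^sub>R f (a + (real k + 1) * ((b - a) / n)))
    \<longlonglongrightarrow> (LBINT u:{a..b}. f u)"
proof -
  define h where "h n = (b - a) / real n" for n
  define J where "J n k = {a + real k * h n<..a + (real k + 1) * h n}" for n k
  define S where "S n u = (\<Sum>k<n. indicator (J n k) u *\<^sub>R f (a + (real k + 1) * h n))" for n u
  \<comment> \<open>The half-open cells miss \<open>a\<close>, so the pointwise limit of
    \<open>S n\<close> vanishes there; the value at this single point is restored at the end without
    changing the integral.\<close>
  define F where "F u = indicator {a<..b} u *\<^sub>R f u" for u
  obtain B where "\<forall>x\<in>f ` {a..b}. norm x \<le> B"
    using bdd unfolding bounded_iff by blast
  then have B: "norm (f u) \<le> B" if "a \<le> u" "u \<le> b" for u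
    using that by auto
  have B0: "0 \<le> B" using B[of a] \<open>a \<le> b\<close> norm_ge_zero[of "f a"] by linarith
  have h0: "0 \<le> h n" for n unfolding h_def using \<open>a \<le> b\<close> by simp
  have hn: "real n * h n = b - a" if "n > 0" for n unfolding h_def using that by simp
  have J_sub: "J n k \<subseteq> {a<..b}" if "k < n" for n k
  proof -
    have "(real k + 1) * h n \<le> real n * h n"
      using that h0 by (intro mult_right_mono) auto
    moreover have "0 \<le> real k * h n" using h0 by simp
    ultimately show ?thesis unfolding J_def using hn[of n] that by auto
  qed
  have step: "\<exists>v. u \<le> v \<and> v \<le> u + h n \<and> v \<le> b \<and> S n u = f v"
    if u: "a < u" "u \<le> b" and n: "n > 0" for u n
  proof -
    have hp: "0 < h n" using u n unfolding h_def by simp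
    \<comment> \<open>The cell containing \<open>u\<close> has the index \<open>c\<close> with
      \<open>c < (u - a) / h n \<le> c + 1\<close>, hence the ceiling minus one.\<close>
    define c where "c = nat (\<lceil>(u - a) / h n\<rceil> - 1)"
    have pos: "0 < (u - a) / h n" using u hp by simp
    then have cz: "real c = of_int \<lceil>(u - a) / h n\<rceil> - 1" unfolding c_def by auto
    have c1: "real c < (u - a) / h n" and c2: "(u - a) / h n \<le> real c + 1"
      unfolding cz by linarith+
    have uc: "u \<in> J n c" unfolding J_def using c1 c2 hp by (auto simp: field_simps)
    have "real c * h n < real n * h n" using uc u hn[OF n] unfolding J_def by auto
    then have cn: "c < n" using hp by simp
    have ind: "indicator (J n k) u = (if k = c then 1 else (0::real))" for k
    proof (cases "k = c")
      case True then show ?thesis using uc by simp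
    next
      case False
      have "u \<notin> J n k"
      proof
        assume "u \<in> J n k"
        then have "real k * h n < (real c + 1) * h n" "real c * h n < (real k + 1) * h n"
          using uc unfolding J_def by auto
        then have "real k < real c + 1" "real c < real k + 1" using hp by simp_all
        then show False using False by linarith
      qed
      then show ?thesis using False by simp
    qed
    have "S n u = (\<Sum>k<n. if k = c then f (a + (real k + 1) * h n) else 0)"
      unfolding S_def ind by (intro sum.cong) auto
    also have "\<dots> = f (a + (real c + 1) * h n)" using cn by simp
    finally have "S n u = f (a + (real c + 1) * h n)" .
    moreover have "a + (real c + 1) * h n \<in> J n c" unfolding J_def using hp by (auto simp: algebra_simps)
    then have "a + (real c + 1) * h n \<le> b" using J_sub[OF cn] by auto
    moreover have "u \<le> a + (real c + 1) * h n" "a + (real c + 1) * h n \<le> u + h n"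
      using uc unfolding J_def by (auto simp: algebra_simps)
    ultimately show ?thesis by metis
  qed
  have S0: "S n u = 0" if "\<not> (a < u \<and> u \<le> b)" for n u
  proof -
    have "u \<notin> J n k" if "k < n" for k using J_sub[OF that] \<open>\<not> (a < u \<and> u \<le> b)\<close> by auto
    then show ?thesis unfolding S_def by simp
  qed
  have lim: "(\<lambda>n. S n u) \<longlonglongrightarrow> F u" for u
  proof (cases "a < u \<and> u \<le> b")
    case False
    then have "F u = 0" unfolding F_def by auto
    then show ?thesis using S0[OF False] by simp
  next
    case True
    \<comment> \<open>The shift to \<open>Suc n\<close> avoids \<open>n = 0\<close>, where
      \<open>S 0\<close> is the empty sum.\<close>
    have "\<exists>v. \<forall>n. u \<le> v n \<and> v n \<le> u + h (Suc n) \<and> v n \<le> b \<and> S (Suc n) u = f (v n)"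
      using step True by (intro choice allI) auto
    then obtain v where v: "\<And>n. u \<le> v n" "\<And>n. v n \<le> u + h (Suc n)" "\<And>n. v n \<le> b"
      "\<And>n. S (Suc n) u = f (v n)" by blast
    have "h \<longlonglongrightarrow> 0" unfolding h_def by (rule lim_const_over_n)
    then have "(\<lambda>n. u + h (Suc n)) \<longlonglongrightarrow> u + 0"
      by (rule tendsto_add[OF tendsto_const LIMSEQ_Suc])
    then have "(\<lambda>n. u + h (Suc n)) \<longlonglongrightarrow> u" by simp
    then have vu: "v \<longlonglongrightarrow> u"
      by (rule real_tendsto_sandwich[OF always_eventually always_eventually tendsto_const, rotated 2]) (use v in auto)
    have "(\<lambda>n. f (v n)) \<longlonglongrightarrow> f u"
    \<comment> \<open>Right continuity is assumed only to the left of \<open>b\<close>; at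
      \<open>b\<close> itself the sample point is squeezed between \<open>u\<close> and
      \<open>b\<close>.\<close>
    proof (cases "u = b")
      case True
      then have "v n = u" for n using v(1,3) by (intro antisym) auto
      then show ?thesis by simp
    next
      case False
      then have "(f \<longlongrightarrow> f u) (at_right u)" using True rc by simp
      then show ?thesis using vu v(1) by (rule right_continuous_sequentially)
    qed
    then have "(\<lambda>n. S (Suc n) u) \<longlonglongrightarrow> F u" unfolding v(4) F_def using True by simp
    then show ?thesis by (rule LIMSEQ_imp_Suc)
  qed
  have bound: "norm (S n u) \<le> B * indicator {a..b} u" for n u
  proof (cases "a < u \<and> u \<le> b \<and> n > 0")
    case True
    then obtain v where "u \<le> v" "v \<le> b" "S n u = f v" using step by blast
    then show ?thesis using B[of v] True by auto
  next
    case False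
    then have "S n u = 0" using S0 by (cases "n = 0") (auto simp: S_def)
    then show ?thesis using B0 by simp
  qed
  have S_meas: "S n \<in> borel_measurable lborel" for n
    unfolding S_def J_def
    by (intro borel_measurable_sum borel_measurable_scaleR borel_measurable_indicator borel_measurable_const) simp
  have F_meas: "F \<in> borel_measurable lborel"
    using S_meas lim by (rule borel_measurable_LIMSEQ_metric)
  have dom: "integrable lborel (\<lambda>u. B * indicator {a..b} u)"
    by (intro integrable_mult_right integrable_real_indicator) (auto simp: emeasure_lborel_Icc_eq)
  note dct = F_meas S_meas dom
  have intF: "integrable lborel F"
    by (rule integrable_dominated_convergence[where s=S, OF F_meas _ dom])
       (use S_meas lim bound in auto)
  have limF: "(\<lambda>n. integral\<^sup>L lborel (S n)) \<longlonglongrightarrow> integral\<^sup>L lborel F"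
    by (rule integral_dominated_convergence[OF dct]) (use lim bound in auto)
  have G_eq: "(\<lambda>u. indicator {a..b} u *\<^sub>R f u) = (\<lambda>u. F u + indicator {a} u *\<^sub>R f a)"
    unfolding F_def using \<open>a \<le> b\<close> by (auto simp: fun_eq_iff split: split_indicator)
  have int_a: "integrable lborel (\<lambda>u. indicator {a} u *\<^sub>R f a)" by simp
  have "(LBINT u:{a..b}. f u) = integral\<^sup>L lborel F"
    unfolding set_lebesgue_integral_def G_eq using intF int_a
    by (subst Bochner_Integration.integral_add) auto
  moreover have "integral\<^sup>L lborel (S n) = (\<Sum>k<n. h n *\<^sub>R f (a + (real k + 1) * h n))" for n
  proof -
    have "integral\<^sup>L lborel (S n)
        = (\<Sum>k<n. \<integral>u. indicator (J n k) u *\<^sub>R f (a + (real k + 1) * h n) \<partial>lborel)"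
      unfolding S_def J_def by (intro Bochner_Integration.integral_sum) (auto simp: algebra_simps h0)
    also have "\<dots> = (\<Sum>k<n. h n *\<^sub>R f (a + (real k + 1) * h n))"
    proof (intro sum.cong refl)
      fix k
      have "a + real k * h n \<le> a + (real k + 1) * h n" using h0 by (simp add: algebra_simps)
      then have "emeasure lborel (J n k) = ennreal (h n)" unfolding J_def by (simp add: algebra_simps)
      moreover have "J n k \<in> sets lborel" unfolding J_def by simp
      ultimately have "has_bochner_integral lborel (indicator (J n k)) (h n)"
        using has_bochner_integral_real_indicator[of "J n k" lborel] h0
        by (simp add: measure_def)
      then show "(\<integral>u. indicator (J n k) u *\<^sub>R f (a + (real k + 1) * h n) \<partial>lborel)
           = h n *\<^sub>R f (a + (real k + 1) * h n)"
        by (intro has_bochner_integral_integral_eq has_bochner_integral_scaleR_left)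
    qed
    finally show ?thesis .
  qed
  ultimately show "(\<lambda>n. \<Sum>k<n. ((b - a) / n) *\<^sub>R f (a + (real k + 1) * ((b - a) / n)))
         \<longlonglongrightarrow> (LBINT u:{a..b}. f u)"
    using limF unfolding h_def by simp
qed

section \<open>Boundedness of cadlag paths on compact intervals\<close>

lemma tendsto_imp_bounded_near:
  fixes f :: "real \<Rightarrow> 'b::real_normed_vector"
  assumes "(f \<longlongrightarrow> l) (at x within T)"
  obtains d where "0 < d" and "\<And>y. y \<in> T \<Longrightarrow> y \<noteq> x \<Longrightarrow> \<bar>y - x\<bar> < d \<Longrightarrow> norm (f y) \<le> norm l + 1"
proof -
  have "eventually (\<lambda>y. dist (f y) l < 1) (at x within T)"
    using assms by (rule tendstoD) simp
  then obtain d where d: "0 < d" "\<And>y. y \<in> T \<Longrightarrow> y \<noteq> x \<Longrightarrow> dist y x < d \<Longrightarrow> dist (f y) l < 1"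
    unfolding eventually_at by blast
  show thesis
  proof (rule that[OF d(1)])
    fix y assume "y \<in> T" "y \<noteq> x" "\<bar>y - x\<bar> < d"
    then have "norm (f y - l) < 1" using d(2)[of y] by (simp add: dist_norm)
    then show "norm (f y) \<le> norm l + 1" using norm_triangle_ineq2[of "f y" l] by linarith
  qed
qed

text \<open>The two one-sided limits and the value at the point bound \<open>f\<close> near each
  point; bisection makes the bound global.\<close>

lemma cadlag_bounded:
  assumes "cadlag f" "0 \<le> a" "a \<le> b"
  shows "bounded (f ` {a..b})"
proof -
  \<comment> \<open>Bisection also meets intervals reaching below \<open>0\<close>, where \<open>f\<close> is unconstrained.\<close>
  define P where "P a b \<longleftrightarrow> bounded (f ` ({a..b} \<inter> {0..}))" for a b
  have "P a b"
    using \<open>a \<le> b\<close>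
  proof (rule Bolzano)
    fix a b c :: real
    assume "P a b" "P b c" "a \<le> b" "b \<le> c"
    moreover from this(3,4) have "{a..c} \<inter> {0..} = ({a..b} \<inter> {0..}) \<union> ({b..c} \<inter> {0..})" by auto
    ultimately show "P a c" unfolding P_def by (simp add: image_Un)
  next
    fix x assume "a \<le> x" "x \<le> b"
    then have x: "0 \<le> x" using \<open>0 \<le> a\<close> by simp
    obtain d B where d: "0 < d" "\<And>y. x < y \<Longrightarrow> \<bar>y - x\<bar> < d \<Longrightarrow> norm (f y) \<le> B"
    proof -
      have "(f \<longlongrightarrow> f x) (at_right x)" using assms(1) x unfolding cadlag_def by blast
      then obtain d where "0 < d"
        "\<And>y. y \<in> {x<..} \<Longrightarrow> y \<noteq> x \<Longrightarrow> \<bar>y - x\<bar> < d \<Longrightarrow> norm (f y) \<le> norm (f x) + 1"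
        by (rule tendsto_imp_bounded_near) blast
      then show ?thesis by (intro that[of d "norm (f x) + 1"]) auto
    qed
    obtain d' B' where d': "0 < d'"
      "\<And>y. 0 \<le> y \<Longrightarrow> y < x \<Longrightarrow> \<bar>y - x\<bar> < d' \<Longrightarrow> norm (f y) \<le> B'"
    proof (cases "x = 0")
      case True
      \<comment> \<open>No nonnegative time lies to the left of \<open>0\<close>, so the constants
        are arbitrary.\<close>
      then show ?thesis by (intro that[of 1 0]) auto
    next
      case False
      then obtain l where "(f \<longlongrightarrow> l) (at_left x)" using assms(1) x unfolding cadlag_def by force
      then obtain d where "0 < d"
        "\<And>y. y \<in> {..<x} \<Longrightarrow> y \<noteq> x \<Longrightarrow> \<bar>y - x\<bar> < d \<Longrightarrow> norm (f y) \<le> norm l + 1"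
        by (rule tendsto_imp_bounded_near) blast
      then show ?thesis by (intro that[of d "norm l + 1"]) auto
    qed
    show "\<exists>d>0. \<forall>a b. a \<le> x \<and> x \<le> b \<and> b - a < d \<longrightarrow> P a b"
    proof (intro exI[of _ "min d d'"] conjI allI impI)
      fix a b assume ab: "a \<le> x \<and> x \<le> b \<and> b - a < min d d'"
      show "P a b" unfolding P_def bounded_iff
      proof (intro exI[of _ "max (norm (f x)) (max B B')"] ballI, elim imageE)
        fix z y assume z: "z = f y" "y \<in> {a..b} \<inter> {0..}"
        consider "y = x" | "x < y" | "y < x" by linarith
        then show "norm z \<le> max (norm (f x)) (max B B')"
        proof cases
          case 1 then show ?thesis using z by simp
        next
          case 2 then have "norm (f y) \<le> B" using z ab by (intro d(2)) auto
          then show ?thesis using z by simp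
        next
          case 3 then have "norm (f y) \<le> B'" using z ab by (intro d'(2)) auto
          then show ?thesis using z by simp
        qed
      qed
    qed (use d(1) d'(1) in auto)
  qed
  moreover have "{a..b} \<inter> {0..} = {a..b}" using \<open>0 \<le> a\<close> by auto
  ultimately show ?thesis unfolding P_def by (simp only:)
qed

section \<open>Continuity and uniqueness of complex logarithms\<close>

text \<open>The exponent is recovered from \<open>(\<psi> - 1) \<integral>\<^sub>0\<^sup>1 exp (t (\<psi> - 1)) dt = exp (\<psi> - 1) - 1\<close>: the
  integral is continuous by dominated convergence, and it does not vanish since \<open>Re \<psi> \<le> 0\<close>.\<close>

lemma continuous_on_exponent:
  fixes \<psi> :: "'a::metric_space \<Rightarrow> complex"
  assumes cont: "\<And>t. 0 \<le> t \<Longrightarrow> t \<le> 1 \<Longrightarrow> continuous_on A (\<lambda>x. exp (of_real t * \<psi> x))"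
    and Re: "\<And>x. x \<in> A \<Longrightarrow> Re (\<psi> x) \<le> 0"
  shows "continuous_on A \<psi>"
proof -
  define I where
    "I x = (\<integral>t. indicator {0..1} t *\<^sub>R exp (of_real t * (\<psi> x - 1)) \<partial>lborel)" for x
  have I_eq: "(\<psi> x - 1) * I x = exp (\<psi> x - 1) - 1" for x
  proof -
    have "(\<integral>t. indicator {0..1} t *\<^sub>R ((\<psi> x - 1) * exp (of_real t * (\<psi> x - 1))) \<partial>lborel)
        = exp (of_real 1 * (\<psi> x - 1)) - exp (of_real 0 * (\<psi> x - 1))"
    proof (rule integral_FTC_atLeastAtMost)
      fix t :: real
      have "((\<lambda>z. exp (z * (\<psi> x - 1))) has_field_derivative
          (\<psi> x - 1) * exp (of_real t * (\<psi> x - 1))) (at (of_real t))"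
        by (auto intro!: derivative_eq_intros)
      then have "((\<lambda>t. exp (of_real t * (\<psi> x - 1))) has_vector_derivative
          (\<psi> x - 1) * exp (of_real t * (\<psi> x - 1))) (at t)"
        by (rule has_vector_derivative_real_field)
      then show "((\<lambda>t. exp (of_real t * (\<psi> x - 1))) has_vector_derivative
          (\<psi> x - 1) * exp (of_real t * (\<psi> x - 1))) (at t within {0..1})"
        by (auto simp: comp_def intro: has_vector_derivative_at_within)
    qed (auto intro!: continuous_intros)
    moreover have "(\<integral>t. indicator {0..1} t *\<^sub>R ((\<psi> x - 1) * exp (of_real t * (\<psi> x - 1))) \<partial>lborel)
        = (\<psi> x - 1) * I x"
      unfolding I_def by (subst integral_mult_right_zero[symmetric]) (simp add: mult.left_commute scaleR_conv_of_real)
    ultimately show ?thesis by simp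
  qed
  have cont_I: "continuous_on A I"
    unfolding continuous_on_sequentially
  proof (intro allI ballI impI, elim conjE)
    fix u a assume a: "a \<in> A" and u: "\<forall>n. u n \<in> A" "u \<longlonglongrightarrow> a"
    have "(\<lambda>n. I (u n)) \<longlonglongrightarrow> I a"
      unfolding I_def
    proof (rule integral_dominated_convergence[where w="\<lambda>t. indicator {0..1::real} t"])
      show "AE t in lborel. (\<lambda>n. indicator {0..1} t *\<^sub>R exp (of_real t * (\<psi> (u n) - 1)))
          \<longlonglongrightarrow> indicator {0..1} t *\<^sub>R exp (of_real t * (\<psi> a - 1))"
      proof (intro AE_I2)
        fix t :: real
        show "(\<lambda>n. indicator {0..1} t *\<^sub>R exp (of_real t * (\<psi> (u n) - 1)))
          \<longlonglongrightarrow> indicator {0..1} t *\<^sub>R exp (of_real t * (\<psi> a - 1))"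
        proof (cases "t \<in> {0..1}")
          case True
          then have "(\<lambda>n. exp (of_real t * \<psi> (u n))) \<longlonglongrightarrow> exp (of_real t * \<psi> a)"
            using cont[of t] a u unfolding continuous_on_sequentially by (auto simp: comp_def)
          then have "(\<lambda>n. exp (of_real t * \<psi> (u n)) / exp (of_real t)) \<longlonglongrightarrow> exp (of_real t * \<psi> a) / exp (of_real t)"
            by (rule tendsto_divide[OF _ tendsto_const]) simp
          then show ?thesis using True by (simp add: right_diff_distrib exp_diff)
        qed simp
      qed
      show "AE t in lborel. norm (indicator {0..1} t *\<^sub>R exp (of_real t * (\<psi> (u n) - 1)))
          \<le> indicator {0..1::real} t" for n
      proof (intro AE_I2)
        fix t :: real
        have "t * (Re (\<psi> (u n)) - 1) \<le> 0" if "0 \<le> t"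
          using Re[of "u n"] u(1) that by (intro mult_nonneg_nonpos) (auto simp: algebra_simps)
        then show "norm (indicator {0..1} t *\<^sub>R exp (of_real t * (\<psi> (u n) - 1))) \<le> indicator {0..1::real} t"
          by (auto split: split_indicator)
      qed
    qed (auto intro!: borel_measurable_continuous_onI continuous_intros)
    then show "(I \<circ> u) \<longlonglongrightarrow> I a" by (simp add: comp_def)
  qed
  \<comment> \<open>The shift by 1 gives \<open>exp (\<psi> x - 1)\<close> a norm of at most
    \<open>exp (-1)\<close>, so it cannot equal 1.\<close>
  have nz: "I x \<noteq> 0" if "x \<in> A" for x
  proof
    assume "I x = 0"
    then have "exp (\<psi> x - 1) = 1" using I_eq[of x] by simp
    then have "norm (exp (\<psi> x - 1)) = 1" by simp
    then show False using Re[OF that] by simp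
  qed
  \<comment> \<open>The identity \<open>I_eq\<close> is solved for \<open>\<psi> x\<close>; the
    remaining exponential is continuous by the hypothesis at \<open>t = 1\<close>.\<close>
  have "\<psi> x = (exp (of_real 1 * \<psi> x) / exp 1 - 1) / I x + 1" if "x \<in> A" for x
    using I_eq[of x] nz[OF that] by (simp add: exp_diff field_simps)
  moreover have "continuous_on A (\<lambda>x. (exp (of_real 1 * \<psi> x) / exp 1 - 1) / I x + 1)"
    using nz by (intro continuous_intros cont cont_I) auto
  ultimately show ?thesis by (simp cong: continuous_on_cong)
qed

text \<open>The difference is an integer multiple of \<open>2 * pi * \<i>\<close>; the multiple is
  continuous in \<open>x\<close>, hence constant, and it is zero at \<open>0\<close>. Agreement on a
  countable dense set is what almost sure equalities for each fixed \<open>x\<close> can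
  supply.\<close>

lemma continuous_log_unique:
  fixes f g :: "real \<Rightarrow> complex"
  assumes f: "continuous_on UNIV f" "f 0 = 0" and g: "continuous_on UNIV g" "g 0 = 0"
    and eq: "\<And>x. x \<in> \<rat> \<Longrightarrow> exp (f x) = exp (g x)"
  shows "f x = g x"
proof -
  have all: "exp (f x) = exp (g x)" for x
  proof -
    have "closed {x. exp (f x) = exp (g x)}"
      using f g by (intro closed_Collect_eq continuous_intros) auto
    then have "closure \<rat> \<subseteq> {x. exp (f x) = exp (g x)}"
      using eq by (intro closure_minimal) auto
    then show ?thesis using Rats_closure_real by auto
  qed
  define d where "d x = (f x - g x) / (2 * of_real pi * \<i>)" for x
  have d_int: "d x \<in> \<int>" for x
  proof -
    obtain n :: int where "f x = g x + of_int (2 * n) * of_real pi * \<i>"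
      using all[of x] unfolding exp_eq by auto
    then have "d x = of_int n" unfolding d_def by simp
    then show ?thesis by simp
  qed
  have "continuous_on UNIV d" unfolding d_def using f g by (intro continuous_intros) auto
  then have "d constant_on UNIV"
  proof (rule continuous_discrete_range_constant[OF connected_UNIV])
    fix x :: real
    show "\<exists>e>0. \<forall>y. y \<in> UNIV \<and> d y \<noteq> d x \<longrightarrow> e \<le> norm (d y - d x)"
    proof (intro exI[of _ 1] conjI allI impI)
      fix y assume y: "y \<in> UNIV \<and> d y \<noteq> d x"
      obtain m n where mn: "d y = of_int m" "d x = of_int n"
        using d_int[of x] d_int[of y] by (auto elim!: Ints_cases)
      then have "1 \<le> \<bar>m - n\<bar>" using y by auto
      then have "1 \<le> norm (of_int (m - n) :: complex)"
        unfolding norm_of_int by (metis of_int_1_le_iff of_int_abs)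
      then show "1 \<le> norm (d y - d x)" using mn by simp
    qed simp
  qed
  then have "d x = d 0" unfolding constant_on_def by auto
  then show ?thesis unfolding d_def using f(2) g(2) by simp
qed

section \<open>Complex conditional expectations, and a summation by parts\<close>

text \<open>\<open>Re\<close> and \<open>Im\<close> are bounded linear, so they commute with the
  integrals, and the real characterization applies to each part.\<close>

lemma complex_cond_exp_charact:
  assumes "finite_measure_subalgebra M F"
    and eq: "\<And>A. A \<in> sets F \<Longrightarrow>
      (\<integral>\<omega>. indicator A \<omega> *\<^sub>R f \<omega> \<partial>M) = (\<integral>\<omega>. indicator A \<omega> *\<^sub>R g \<omega> \<partial>M)"
    and f: "integrable M f" and g: "integrable M g" and meas: "g \<in> borel_measurable F"
  shows "AE \<omega> in M. complex_cond_exp M F f \<omega> = g \<omega>"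
proof -
  interpret finite_measure_subalgebra M F by fact
  have A: "A \<in> sets M" if "A \<in> sets F" for A
    using subalg that unfolding subalgebra_def by auto
  have int: "integrable M (\<lambda>\<omega>. indicator A \<omega> *\<^sub>R f \<omega>)" "integrable M (\<lambda>\<omega>. indicator A \<omega> *\<^sub>R g \<omega>)"
    if "A \<in> sets F" for A
    using f g A[OF that] by (auto intro: integrable_mult_indicator)
  have sets_eq: "(\<integral>\<omega>. indicator A \<omega> *\<^sub>R r (f \<omega>) \<partial>M) = (\<integral>\<omega>. indicator A \<omega> *\<^sub>R r (g \<omega>) \<partial>M)"
    if "A \<in> sets F" "bounded_linear r" for A and r :: "complex \<Rightarrow> real"
    using arg_cong[OF eq[OF that(1)], of r]
    by (simp only: integral_bounded_linear[OF that(2) int(1)[OF that(1)], symmetric]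
        integral_bounded_linear[OF that(2) int(2)[OF that(1)], symmetric] linear_simps(5)[OF that(2)])
  have "AE \<omega> in M. real_cond_exp M F (\<lambda>\<omega>. Re (f \<omega>)) \<omega> = Re (g \<omega>)"
    using f g meas sets_eq[where r=Re]
    by (intro real_cond_exp_charact)
       (auto simp: set_lebesgue_integral_def bounded_linear_Re)
  moreover have "AE \<omega> in M. real_cond_exp M F (\<lambda>\<omega>. Im (f \<omega>)) \<omega> = Im (g \<omega>)"
    using f g meas sets_eq[where r=Im]
    by (intro real_cond_exp_charact)
       (auto simp: set_lebesgue_integral_def bounded_linear_Im)
  ultimately show ?thesis
    by eventually_elim (simp add: complex_cond_exp_def)
qed

text \<open>Increment \<open>k\<close> occurs in \<open>f (Suc j) - f 0\<close> exactly when
  \<open>k \<le> j\<close>, hence for \<open>n - k\<close> of the indices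
  \<open>j < n\<close>.\<close>

lemma sum_diff_first:
  fixes f :: "nat \<Rightarrow> real"
  shows "(\<Sum>k<n. f (Suc k) - f 0) = (\<Sum>k<n. real (n - k) * (f (Suc k) - f k))"
proof (induction n)
  case (Suc n)
  have "(\<Sum>k<Suc n. real (Suc n - k) * (f (Suc k) - f k))
      = (\<Sum>k<Suc n. real (n - k) * (f (Suc k) - f k) + (f (Suc k) - f k))"
    by (intro sum.cong) (auto simp: Suc_diff_le algebra_simps)
  \<comment> \<open>The extra term \<open>k = n\<close> has weight \<open>n - n = 0\<close>, and the
    second summands telescope.\<close>
  also have "\<dots> = (\<Sum>k<n. real (n - k) * (f (Suc k) - f k)) + (f (Suc n) - f 0)"
    unfolding sum.distrib sum_lessThan_telescope by simp
  finally show ?case using Suc.IH by simp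
qed simp


section \<open>Characteristic exponent and independent increments\<close>

context levy_process
begin

lemma char_distr_eq:
  "f \<in> borel_measurable M \<Longrightarrow> char (distr M borel f) x = (\<integral>\<omega>. iexp (x * f \<omega>) \<partial>M)"
  unfolding char_def by (subst integral_distr) auto

lemma exponent_Re_nonpos:
  assumes "characteristic_exponent M X \<psi>"
  shows "Re (\<psi> x) \<le> 0"
proof -
  have "real_distribution (distr M borel (X 1))"
    using random_variable[of 1] by (intro real_distribution_distr) simp
  then have "norm (char (distr M borel (X 1)) x) \<le> 1" by (rule real_distribution.cmod_char_le_1)
  also have "char (distr M borel (X 1)) x = exp (of_real 1 * \<psi> x)"
    using assms unfolding characteristic_exponent_def by (metis zero_le_one)
  finally show ?thesis by simp
qed

lemma exponent_continuous:
  assumes "characteristic_exponent M X \<psi>"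
  shows "continuous_on UNIV \<psi>"
proof (rule continuous_on_exponent)
  fix t :: real assume "0 \<le> t" "t \<le> 1"
  then have "real_distribution (distr M borel (X t))"
    using random_variable[of t] by (intro real_distribution_distr) simp
  then have "continuous_on UNIV (char (distr M borel (X t)))"
    by (intro continuous_at_imp_continuous_on ballI real_distribution.isCont_char)
  also have "char (distr M borel (X t)) = (\<lambda>x. exp (of_real t * \<psi> x))"
    using assms \<open>0 \<le> t\<close> unfolding characteristic_exponent_def by auto
  finally show "continuous_on UNIV (\<lambda>x. exp (of_real t * \<psi> x))" .
qed (rule exponent_Re_nonpos[OF assms])

text \<open>One value of \<open>t\<close> determines \<open>\<psi> 0\<close> only up to multiples of
  \<open>2 * pi * \<i>\<close>. Letting \<open>t\<close> vary makes \<open>t * \<psi> 0\<close> a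
  continuous logarithm of 1 that vanishes at \<open>t = 0\<close>.\<close>

lemma exponent_zero:
  assumes "characteristic_exponent M X \<psi>"
  shows "\<psi> 0 = 0"
proof -
  have one: "exp (of_real t * \<psi> 0) = 1" if "0 \<le> t" for t
  proof -
    have "real_distribution (distr M borel (X t))"
      using random_variable[OF that] by (intro real_distribution_distr)
    then show ?thesis
      using assms that real_distribution.char_zero unfolding characteristic_exponent_def by metis
  qed
  \<comment> \<open>The absolute value extends the half-line of times to the whole line, as
    \<open>continuous_log_unique\<close> demands.\<close>
  have "continuous_on UNIV (\<lambda>t. of_real \<bar>t\<bar> * \<psi> 0)" by (intro continuous_intros)
  then have "of_real \<bar>1\<bar> * \<psi> 0 = (\<lambda>_::real. 0::complex) 1"
    by (rule continuous_log_unique) (use one in auto)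
  then show ?thesis by simp
qed

lemma expectation_iexp_increment:
  assumes "characteristic_exponent M X \<psi>" "0 \<le> s" "0 \<le> h"
  shows "(\<integral>\<omega>. iexp (x * (X (s + h) \<omega> - X s \<omega>)) \<partial>M) = exp (of_real h * \<psi> x)"
proof -
  have "(\<integral>\<omega>. iexp (x * (X (s + h) \<omega> - X s \<omega>)) \<partial>M)
      = char (distr M borel (\<lambda>\<omega>. X (s + h) \<omega> - X s \<omega>)) x"
    using assms random_variable by (subst char_distr_eq) auto
  then show ?thesis
    using assms stationary_increments[of s h] unfolding characteristic_exponent_def by simp
qed

text \<open>Up to a null set \<open>X s\<close> is the increment from time 0 to \<open>s\<close>, so
  it is independent of the later increments. The bounded test function \<open>G\<close> will carry
  the conditioning event.\<close>

lemma expectation_prod_increments: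
  fixes G :: "real \<Rightarrow> complex" and c :: "nat \<Rightarrow> real"
  assumes \<psi>: "characteristic_exponent M X \<psi>" and s: "0 \<le> s" and h: "0 \<le> h"
    and G: "G \<in> borel_measurable borel" "\<And>y. norm (G y) \<le> B"
  shows "(\<integral>\<omega>. G (X s \<omega>) *
        (\<Prod>k<n. iexp (c k * (X (s + (real k + 1) * h) \<omega> - X (s + real k * h) \<omega>))) \<partial>M)
      = (\<integral>\<omega>. G (X s \<omega>) \<partial>M) * (\<Prod>k<n. exp (of_real h * \<psi> (c k)))"
proof -
  define D where "D k \<omega> = X (s + (real k + 1) * h) \<omega> - X (s + real k * h) \<omega>" for k \<omega>
  have X0: "AE \<omega> in M. X 0 \<omega> = 0" by (rule starts_at_zero)
  have rv: "X (s + real k * h) \<in> borel_measurable M" "X (s + (real k + 1) * h) \<in> borel_measurable M" for k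
    using s h by (auto intro!: random_variable)
  have rvX: "X s \<in> borel_measurable M" "X 0 \<in> borel_measurable M" using s by (auto intro: random_variable)
  have D_meas: "D k \<in> borel_measurable M" for k
    unfolding D_def using rv by measurable
  have D_exp: "(\<integral>\<omega>. iexp (c k * D k \<omega>) \<partial>M) = exp (of_real h * \<psi> (c k))" for k
    using expectation_iexp_increment[OF \<psi>, of "s + real k * h" h "c k"] s h
    unfolding D_def by (simp add: algebra_simps)
  have D_int: "integrable M (\<lambda>\<omega>. iexp (c k * D k \<omega>))" for k
    using D_meas by (intro integrable_iexp) auto
  have "(\<integral>\<omega>. G (X s \<omega>) * (\<Prod>k<n. iexp (c k * D k \<omega>)) \<partial>M)
      = (\<integral>\<omega>. G (X s \<omega>) \<partial>M) * (\<Prod>k<n. \<integral>\<omega>. iexp (c k * D k \<omega>) \<partial>M)"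
  proof -
    \<comment> \<open>Independence is available for strictly increasing times: \<open>h = 0\<close>
      merges all grid times, and \<open>s = 0\<close> merges the first one with time 0.\<close>
    consider "h = 0" | "h > 0" "s = 0" | "h > 0" "s > 0" using s h by linarith
    then show ?thesis
    proof cases
      case 1
      then have "D k \<omega> = 0" for k \<omega> unfolding D_def by simp
      then show ?thesis by (simp add: prob_space)
    next
      case 2
      define \<tau> where "\<tau> i = real i * h" for i
      have "indep_vars (\<lambda>_. borel) (\<lambda>i \<omega>. X (\<tau> (Suc i)) \<omega> - X (\<tau> i) \<omega>) {..<n}"
        by (rule independent_increments) (use 2 in \<open>auto simp: \<tau>_def\<close>)
      then have "indep_vars (\<lambda>_. borel) (\<lambda>i \<omega>. iexp (c i * (X (\<tau> (Suc i)) \<omega> - X (\<tau> i) \<omega>))) {..<n}"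
        by (rule indep_vars_compose2) measurable
      moreover have "X (\<tau> (Suc i)) \<omega> - X (\<tau> i) \<omega> = D i \<omega>" for i \<omega>
        unfolding D_def \<tau>_def using 2 by (simp add: algebra_simps)
      ultimately have ind: "indep_vars (\<lambda>_. borel) (\<lambda>i \<omega>. iexp (c i * D i \<omega>)) {..<n}" by simp
      \<comment> \<open>For \<open>s = 0\<close> the test function is almost surely constant and
        factors out.\<close>
      have const: "AE \<omega> in M. G (X s \<omega>) = G 0" using X0 2 by auto
      have "(\<integral>\<omega>. G (X s \<omega>) * (\<Prod>k<n. iexp (c k * D k \<omega>)) \<partial>M)
          = (\<integral>\<omega>. G 0 * (\<Prod>k<n. iexp (c k * D k \<omega>)) \<partial>M)"
        using const G(1) rvX D_meas by (intro integral_cong_AE) (auto simp: measurable_compose)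
      also have "\<dots> = G 0 * (\<Prod>k<n. \<integral>\<omega>. iexp (c k * D k \<omega>) \<partial>M)"
        using indep_vars_lebesgue_integral[OF _ ind] D_int by simp
      also have "G 0 = (\<integral>\<omega>. G (X s \<omega>) \<partial>M)"
      proof -
        have "(\<integral>\<omega>. G (X s \<omega>) \<partial>M) = (\<integral>\<omega>. G 0 \<partial>M)"
          using const G(1) rvX by (intro integral_cong_AE) auto
        then show ?thesis by (simp add: prob_space)
      qed
      finally show ?thesis .
    next
      case 3
      \<comment> \<open>Time 0 is put in front of the grid, so that \<open>G\<close> acts on the
        increment of index 0 and the exponentials on the others.\<close>
      define \<tau> where "\<tau> i = (case i of 0 \<Rightarrow> 0 | Suc k \<Rightarrow> s + real k * h)" for i
      define Y where "Y i y = (case i of 0 \<Rightarrow> G y | Suc k \<Rightarrow> iexp (c k * y))" for i y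
      define Z where "Z i \<omega> = Y i (X (\<tau> (Suc i)) \<omega> - X (\<tau> i) \<omega>)" for i \<omega>
      have "indep_vars (\<lambda>_. borel) (\<lambda>i \<omega>. X (\<tau> (Suc i)) \<omega> - X (\<tau> i) \<omega>) {..<Suc n}"
        by (rule independent_increments) (use 3 in \<open>auto simp: \<tau>_def split: nat.split\<close>)
      then have ind: "indep_vars (\<lambda>_. borel) Z {..<Suc n}"
        unfolding Z_def
        by (rule indep_vars_compose2) (use G(1) in \<open>auto simp: Y_def split: nat.split\<close>)
      have Z0: "Z 0 = (\<lambda>\<omega>. G (X s \<omega> - X 0 \<omega>))"
        unfolding Z_def Y_def \<tau>_def by simp
      have ZS: "Z (Suc k) = (\<lambda>\<omega>. iexp (c k * D k \<omega>))" for k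
        unfolding Z_def Y_def \<tau>_def D_def by (simp add: algebra_simps)
      \<comment> \<open>\<open>Z 0\<close> is a function of \<open>X s - X 0\<close>, which agrees
        with \<open>X s\<close> only almost surely.\<close>
      have AE0: "AE \<omega> in M. Z 0 \<omega> = G (X s \<omega>)" unfolding Z0 using X0 by auto
      have meas0: "Z 0 \<in> borel_measurable M" unfolding Z0 using G(1) rvX by measurable
      have int: "integrable M (Z i)" for i
      proof (cases i)
        case 0
        have "integrable M (Z 0)"
          using meas0 G(2) by (intro integrable_const_bound[of _ B]) (auto simp: Z0)
        then show ?thesis using 0 by simp
      qed (use D_int in \<open>simp add: ZS\<close>)
      have "(\<integral>\<omega>. G (X s \<omega>) * (\<Prod>k<n. iexp (c k * D k \<omega>)) \<partial>M) = (\<integral>\<omega>. (\<Prod>i<Suc n. Z i \<omega>) \<partial>M)"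
      proof (rule integral_cong_AE)
        show "AE \<omega> in M. G (X s \<omega>) * (\<Prod>k<n. iexp (c k * D k \<omega>)) = (\<Prod>i<Suc n. Z i \<omega>)"
          using AE0 by eventually_elim (simp add: prod.lessThan_Suc_shift ZS del: prod.lessThan_Suc)
        show "(\<lambda>\<omega>. G (X s \<omega>) * (\<Prod>k<n. iexp (c k * D k \<omega>))) \<in> borel_measurable M"
          using G(1) rvX D_meas by measurable
        show "(\<lambda>\<omega>. \<Prod>i<Suc n. Z i \<omega>) \<in> borel_measurable M"
          using int by (intro borel_measurable_prod) auto
      qed
      also have "\<dots> = (\<Prod>i<Suc n. \<integral>\<omega>. Z i \<omega> \<partial>M)"
        using ind int by (intro indep_vars_lebesgue_integral) auto
      also have "\<dots> = (\<integral>\<omega>. Z 0 \<omega> \<partial>M) * (\<Prod>k<n. \<integral>\<omega>. iexp (c k * D k \<omega>) \<partial>M)"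
        by (simp add: prod.lessThan_Suc_shift ZS del: prod.lessThan_Suc)
      also have "(\<integral>\<omega>. Z 0 \<omega> \<partial>M) = (\<integral>\<omega>. G (X s \<omega>) \<partial>M)"
        using AE0 meas0 G(1) rvX by (intro integral_cong_AE) auto
      finally show ?thesis .
    qed
  qed
  then show ?thesis unfolding D_exp by (simp add: D_def)
qed

section \<open>The time integral and the exponent integral as limits of Riemann sums\<close>

lemma time_integral_riemann_sums:
  assumes "\<omega> \<in> space M" "0 \<le> s" "s \<le> t"
  shows "(\<lambda>n. \<Sum>k<n. ((t - s) / n) * X (s + (real k + 1) * ((t - s) / n)) \<omega>)
    \<longlonglongrightarrow> time_integral X s t \<omega>"
proof -
  have "cadlag (\<lambda>u. X u \<omega>)" using assms(1) by (rule cadlag_paths)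
  then show ?thesis
    using right_riemann_sums_tendsto[of s t "\<lambda>u. X u \<omega>"] cadlag_bounded[of "\<lambda>u. X u \<omega>" s t] assms
    unfolding time_integral_def cadlag_def by simp
qed

lemma time_integral_measurable:
  assumes "0 \<le> s" "s \<le> t"
  shows "time_integral X s t \<in> borel_measurable M"
proof (rule borel_measurable_LIMSEQ_real)
  show "(\<lambda>\<omega>. \<Sum>k<n. ((t - s) / n) * X (s + (real k + 1) * ((t - s) / n)) \<omega>) \<in> borel_measurable M" for n
    using assms by (intro borel_measurable_sum borel_measurable_times borel_measurable_const random_variable) simp
qed (rule time_integral_riemann_sums[OF _ assms])

text \<open>The reflection \<open>v = t - u\<close> moves the integral to \<open>{0..t - s}\<close>,
  where the right endpoints are the multiples of the mesh that appear as weights of the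
  increments.\<close>

lemma exponent_integral_riemann_sums:
  assumes \<psi>: "characteristic_exponent M X \<psi>" and "s \<le> t"
  shows "(\<lambda>n. \<Sum>k<n. of_real ((t - s) / n) * \<psi> (x * ((real k + 1) * ((t - s) / n))))
    \<longlonglongrightarrow> (CLBINT u:{s..t}. \<psi> (x * (t - u)))"
proof -
  define g where "g v = \<psi> (x * v)" for v
  have cont: "continuous_on A g" for A
    unfolding g_def
    by (intro continuous_on_compose2[OF exponent_continuous[OF \<psi>]] continuous_intros) auto
  have "(\<lambda>n. \<Sum>k<n. ((t - s - 0) / n) *\<^sub>R g (0 + (real k + 1) * ((t - s - 0) / n)))
      \<longlonglongrightarrow> (LBINT u:{0..t - s}. g u)"
  proof (rule right_riemann_sums_tendsto)
    show "bounded (g ` {0..t - s})"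
      by (intro compact_imp_bounded compact_continuous_image cont) auto
    show "(g \<longlongrightarrow> g u) (at_right u)" for u
      using cont[of UNIV] by (auto simp: continuous_on_eq_continuous_at isCont_def intro: tendsto_within_subset)
  qed (use \<open>s \<le> t\<close> in simp)
  moreover have "(LBINT u:{0..t - s}. g u) = (CLBINT u:{s..t}. g (t - u))"
    unfolding set_lebesgue_integral_def
    by (subst lborel_integral_real_affine[where c="-1" and t=t])
       (auto intro!: Bochner_Integration.integral_cong split: split_indicator)
  ultimately show ?thesis by (simp add: g_def scaleR_conv_of_real)
qed

lemma exponent_integral_continuous:
  assumes \<psi>: "characteristic_exponent M X \<psi>"
  shows "continuous_on UNIV (\<lambda>x. CLBINT u:{s..t}. \<psi> (x * (t - u)))"
proof -
  have "set_integrable lborel {s..t} (\<lambda>u. \<psi> (x * (t - u)))" for x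
    by (intro borel_integrable_atLeastAtMost' continuous_on_compose2[OF exponent_continuous[OF \<psi>]] continuous_intros) auto
  \<comment> \<open>Rewriting as a gauge integral makes the theorem on continuous dependence on a
    parameter applicable.\<close>
  then have eq: "(CLBINT u:{s..t}. \<psi> (x * (t - u))) = integral (cbox s t) (\<lambda>u. \<psi> (x * (t - u)))" for x
    by (simp add: set_borel_integral_eq_integral)
  show ?thesis
    unfolding eq
  proof (rule integral_continuous_on_param)
    show "continuous_on (UNIV \<times> cbox s t) (\<lambda>(x, u). \<psi> (x * (t - u)))"
      unfolding case_prod_beta
      by (intro continuous_on_compose2[OF exponent_continuous[OF \<psi>]] continuous_intros) auto
  qed
qed

text \<open>For \<open>G\<close> the indicator of a Borel set this is the defining identity of the
  conditional expectation given \<open>X s\<close>. Both sides are limits of one sequence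
  \<open>E\<close>, in which Riemann sums replace the time integral.\<close>

lemma expectation_iexp_time_integral:
  fixes G :: "real \<Rightarrow> complex"
  assumes \<psi>: "characteristic_exponent M X \<psi>" and s: "0 \<le> s" and t: "s \<le> t"
    and G: "G \<in> borel_measurable borel" "\<And>y. norm (G y) \<le> B"
  shows "(\<integral>\<omega>. G (X s \<omega>) * iexp (x * time_integral X s t \<omega>) \<partial>M)
    = (\<integral>\<omega>. G (X s \<omega>) * iexp (x * X s \<omega> * (t - s)) \<partial>M)
      * exp (CLBINT u:{s..t}. \<psi> (x * (t - u)))"
proof (rule LIMSEQ_unique)
  define h where "h n = (t - s) / real n" for n
  define R where "R n \<omega> = (\<Sum>k<n. h n * X (s + (real k + 1) * h n) \<omega>)" for n \<omega>
  define E where "E n = (\<integral>\<omega>. G (X s \<omega>) * iexp (x * R n \<omega>) \<partial>M)" for n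
  have h0: "0 \<le> h n" for n unfolding h_def using t by simp
  have rvX[measurable]: "X s \<in> borel_measurable M" using s by (rule random_variable)
  have R_meas[measurable]: "R n \<in> borel_measurable M" for n
    unfolding R_def using s h0
    by (intro borel_measurable_sum borel_measurable_times borel_measurable_const random_variable) simp
  note [measurable] = G(1) time_integral_measurable[OF s t]
  show "E \<longlonglongrightarrow> (\<integral>\<omega>. G (X s \<omega>) * iexp (x * time_integral X s t \<omega>) \<partial>M)"
    unfolding E_def
  proof (rule integral_dominated_convergence[where w="\<lambda>_. B"])
    show "AE \<omega> in M. (\<lambda>n. G (X s \<omega>) * iexp (x * R n \<omega>))
        \<longlonglongrightarrow> G (X s \<omega>) * iexp (x * time_integral X s t \<omega>)"
      using time_integral_riemann_sums[OF _ s t] unfolding R_def h_def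
      by (intro AE_I2 tendsto_intros) auto
    show "AE \<omega> in M. norm (G (X s \<omega>) * iexp (x * R n \<omega>)) \<le> B" for n
      using G(2) by (auto simp: norm_mult)
  qed auto
  \<comment> \<open>\<open>G'\<close> absorbs the part of the exponent known at time
    \<open>s\<close>; the new factor has modulus one, so the bound \<open>B\<close>
    persists.\<close>
  define G' where "G' y = G y * iexp (x * y * (t - s))" for y
  have G': "G' \<in> borel_measurable borel" "norm (G' y) \<le> B" for y
    using G(2) unfolding G'_def by (auto simp: norm_mult)
  \<comment> \<open>The identity \<open>h n * real n = t - s\<close> requires \<open>n > 0\<close>;
    the limit ignores the single exception.\<close>
  have E_eq: "E n = (\<integral>\<omega>. G' (X s \<omega>) \<partial>M)
      * exp (\<Sum>k<n. of_real (h n) * \<psi> (x * ((real k + 1) * h n)))" if n: "n > 0" for n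
  proof -
    \<comment> \<open>The factor \<open>n - k\<close> counts the Riemann summands that contain the
      increment \<open>D k\<close>.\<close>
    define c where "c k = x * h n * real (n - k)" for k
    define D where "D k \<omega> = X (s + (real k + 1) * h n) \<omega> - X (s + real k * h n) \<omega>" for k \<omega>
    have R_eq: "x * R n \<omega> = x * X s \<omega> * (t - s) + (\<Sum>k<n. c k * D k \<omega>)" for \<omega>
    proof -
      have "(\<Sum>k<n. X (s + (real k + 1) * h n) \<omega> - X s \<omega>) = (\<Sum>k<n. real (n - k) * D k \<omega>)"
        using sum_diff_first[of "\<lambda>k. X (s + real k * h n) \<omega>" n] by (simp add: D_def add.commute)
      then have "(\<Sum>k<n. X (s + (real k + 1) * h n) \<omega>) = real n * X s \<omega> + (\<Sum>k<n. real (n - k) * D k \<omega>)"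
        by (simp add: sum_subtractf)
      moreover have "h n * real n = t - s" using n unfolding h_def by simp
      ultimately have "R n \<omega> = (t - s) * X s \<omega> + h n * (\<Sum>k<n. real (n - k) * D k \<omega>)"
        unfolding R_def by (simp add: sum_distrib_left[symmetric] distrib_left mult.assoc[symmetric])
      then show ?thesis
        unfolding c_def by (simp add: distrib_left sum_distrib_left mult_ac)
    qed
    have "G (X s \<omega>) * iexp (x * R n \<omega>) = G' (X s \<omega>) * (\<Prod>k<n. iexp (c k * D k \<omega>))" for \<omega>
      unfolding R_eq G'_def by (simp add: exp_sum[symmetric] exp_add[symmetric] distrib_left sum_distrib_left)
    then have "E n = (\<integral>\<omega>. G' (X s \<omega>) \<partial>M) * (\<Prod>k<n. exp (of_real (h n) * \<psi> (c k)))"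
      unfolding E_def D_def using expectation_prod_increments[OF \<psi> s h0 G'] by simp
    also have "(\<Prod>k<n. exp (of_real (h n) * \<psi> (c k))) = exp (\<Sum>k<n. of_real (h n) * \<psi> (c k))"
      by (simp add: exp_sum)
    \<comment> \<open>The weights decrease from \<open>n\<close> to 1 times the mesh; reversing the
      order of summation puts the sample points in increasing order.\<close>
    also have "(\<Sum>k<n. of_real (h n) * \<psi> (c k))
        = (\<Sum>k<n. of_real (h n) * \<psi> (x * ((real (n - Suc k) + 1) * h n)))"
    proof (intro sum.cong refl)
      fix k assume "k \<in> {..<n}"
      then have "real (n - k) = real (n - Suc k) + 1" by auto
      then show "of_real (h n) * \<psi> (c k) = of_real (h n) * \<psi> (x * ((real (n - Suc k) + 1) * h n))"
        unfolding c_def by (simp add: mult_ac)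
    qed
    also have "\<dots> = (\<Sum>k<n. of_real (h n) * \<psi> (x * ((real k + 1) * h n)))"
      by (rule sum.nat_diff_reindex[where g="\<lambda>k. of_real (h n) * \<psi> (x * ((real k + 1) * h n))"])
    finally show ?thesis .
  qed
  have "(\<lambda>n. (\<integral>\<omega>. G' (X s \<omega>) \<partial>M) * exp (\<Sum>k<n. of_real (h n) * \<psi> (x * ((real k + 1) * h n))))
      \<longlonglongrightarrow> (\<integral>\<omega>. G' (X s \<omega>) \<partial>M) * exp (CLBINT u:{s..t}. \<psi> (x * (t - u)))"
    unfolding h_def by (intro tendsto_intros exponent_integral_riemann_sums[OF \<psi> t])
  then show "E \<longlonglongrightarrow> (\<integral>\<omega>. G (X s \<omega>) * iexp (x * X s \<omega> * (t - s)) \<partial>M)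
      * exp (CLBINT u:{s..t}. \<psi> (x * (t - u)))"
    unfolding G'_def[symmetric]
    by (rule Lim_transform_eventually)
       (use E_eq in \<open>auto intro!: eventually_mono[OF eventually_gt_at_top[of 0]]\<close>)
qed

end

section \<open>Existence and uniqueness of the conditional log-characteristic function\<close>

theorem corollary4p1:
  fixes M :: "'a measure"
    and L :: "real \<Rightarrow> 'a \<Rightarrow> real"
    and \<psi> :: "real \<Rightarrow> complex"
    and s t :: real
  assumes "levy_process M L"
    and "characteristic_exponent M L \<psi>"
    and "0 \<le> s" and "s \<le> t"
  shows "cond_log_char M (sigma_gen M (L s)) (time_integral L s t)
           (\<lambda>\<omega> x. \<i> * of_real x * of_real (L s \<omega>) * of_real (t - s)
                    + (CLBINT u:{s..t}. \<psi> (x * (t - u))))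
       \<and> (\<forall>\<Psi>. cond_log_char M (sigma_gen M (L s)) (time_integral L s t) \<Psi> \<longrightarrow>
            (AE \<omega> in M. \<forall>x. \<Psi> \<omega> x = \<i> * of_real x * of_real (L s \<omega>) * of_real (t - s)
                    + (CLBINT u:{s..t}. \<psi> (x * (t - u)))))"
proof -
  interpret levy_process M L by fact
  note \<psi> = assms(2) and s = assms(3) and t = assms(4)
  define F where "F = sigma_gen M (L s)"
  define Y where "Y = time_integral L s t"
  define \<Phi> where "\<Phi> \<omega> x = \<i> * of_real x * of_real (L s \<omega>) * of_real (t - s)
      + (CLBINT u:{s..t}. \<psi> (x * (t - u)))" for \<omega> x
  have Ls: "L s \<in> borel_measurable M" using s by (rule random_variable)
  have Y_meas: "Y \<in> borel_measurable M" unfolding Y_def using s t by (rule time_integral_measurable)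
  have F_sets: "sets F = {L s -` B \<inter> space M | B. B \<in> sets borel}"
    unfolding F_def sigma_gen_def by (rule sets_vimage_algebra2) simp
  have LsF: "L s \<in> borel_measurable F"
    unfolding F_def sigma_gen_def by (rule measurable_vimage_algebra1) simp
  have sub: "finite_measure_subalgebra M F"
  proof
    show "subalgebra M F"
      using Ls unfolding subalgebra_def F_sets by (auto simp: F_def sigma_gen_def measurable_sets)
  qed
  have \<Phi>_cont: "continuous_on UNIV (\<Phi> \<omega>)" for \<omega>
    unfolding \<Phi>_def by (intro continuous_intros exponent_integral_continuous[OF \<psi>])
  have \<Phi>_0: "\<Phi> \<omega> 0 = 0" for \<omega>
    unfolding \<Phi>_def by (simp add: exponent_zero[OF \<psi>])
  have \<Phi>_exp: "exp (\<Phi> \<omega> x) = iexp (x * L s \<omega> * (t - s)) * exp (CLBINT u:{s..t}. \<psi> (x * (t - u)))"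
    for \<omega> x unfolding \<Phi>_def by (simp add: exp_add mult.assoc)
  have cond: "AE \<omega> in M. complex_cond_exp M F (\<lambda>\<omega>. iexp (x * Y \<omega>)) \<omega> = exp (\<Phi> \<omega> x)" for x
  proof (rule complex_cond_exp_charact[OF sub])
    fix A assume "A \<in> sets F"
    then obtain B where B: "B \<in> sets borel" "A = L s -` B \<inter> space M" unfolding F_sets by auto
    \<comment> \<open>An event of \<open>F\<close> is a preimage under \<open>L s\<close>, so its
      indicator is a Borel function of \<open>L s\<close> and can serve as the test
      function.\<close>
    have ind: "indicator A \<omega> *\<^sub>R z = indicator B (L s \<omega>) * z" if "\<omega> \<in> space M" for \<omega> and z :: complex
      using that B(2) by (auto split: split_indicator)
    have "(\<integral>\<omega>. indicator A \<omega> *\<^sub>R iexp (x * Y \<omega>) \<partial>M) = (\<integral>\<omega>. indicator B (L s \<omega>) * iexp (x * Y \<omega>) \<partial>M)"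
      by (intro Bochner_Integration.integral_cong refl ind)
    also have "\<dots> = (\<integral>\<omega>. indicator B (L s \<omega>) * iexp (x * L s \<omega> * (t - s)) \<partial>M)
        * exp (CLBINT u:{s..t}. \<psi> (x * (t - u)))"
      unfolding Y_def using B(1)
      by (intro expectation_iexp_time_integral[OF \<psi> s t, of _ 1]) (auto split: split_indicator)
    also have "\<dots> = (\<integral>\<omega>. indicator B (L s \<omega>) * exp (\<Phi> \<omega> x) \<partial>M)"
      unfolding \<Phi>_exp by (simp add: mult.assoc[symmetric])
    also have "\<dots> = (\<integral>\<omega>. indicator A \<omega> *\<^sub>R exp (\<Phi> \<omega> x) \<partial>M)"
      by (intro Bochner_Integration.integral_cong refl ind[symmetric])
    finally show "(\<integral>\<omega>. indicator A \<omega> *\<^sub>R iexp (x * Y \<omega>) \<partial>M)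
        = (\<integral>\<omega>. indicator A \<omega> *\<^sub>R exp (\<Phi> \<omega> x) \<partial>M)" .
  next
    show "integrable M (\<lambda>\<omega>. iexp (x * Y \<omega>))"
      using Y_meas by (intro integrable_iexp) auto
    show "integrable M (\<lambda>\<omega>. exp (\<Phi> \<omega> x))"
      unfolding \<Phi>_exp using Ls by (intro integrable_mult_left integrable_iexp) auto
    show "(\<lambda>\<omega>. exp (\<Phi> \<omega> x)) \<in> borel_measurable F"
      unfolding \<Phi>_exp using LsF by measurable
  qed
  have exists: "cond_log_char M F Y \<Phi>"
    unfolding cond_log_char_def
  proof (intro conjI allI)
    show "AE \<omega> in M. continuous_on UNIV (\<Phi> \<omega>) \<and> \<Phi> \<omega> 0 = 0"
      using \<Phi>_cont \<Phi>_0 by simp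
    show "AE \<omega> in M. exp (\<Phi> \<omega> x) = complex_cond_exp M F (\<lambda>\<omega>. iexp (x * Y \<omega>)) \<omega>" for x
      using cond[of x] by eventually_elim simp
  qed
  have unique: "AE \<omega> in M. \<forall>x. \<Psi> \<omega> x = \<Phi> \<omega> x" if \<Psi>: "cond_log_char M F Y \<Psi>" for \<Psi>
  proof -
    \<comment> \<open>The exceptional null set depends on \<open>x\<close>; over the countably many
      rationals the union is still null, and continuity then covers every real
      \<open>x\<close>.\<close>
    have "AE \<omega> in M. \<forall>x\<in>\<rat>. exp (\<Psi> \<omega> x) = exp (\<Phi> \<omega> x)"
    proof (intro AE_ball_countable[THEN iffD2] ballI countable_rat)
      fix x :: real
      have "AE \<omega> in M. exp (\<Psi> \<omega> x) = complex_cond_exp M F (\<lambda>\<omega>. iexp (x * Y \<omega>)) \<omega>"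
        using \<Psi> unfolding cond_log_char_def by blast
      then show "AE \<omega> in M. exp (\<Psi> \<omega> x) = exp (\<Phi> \<omega> x)"
        using cond[of x] by eventually_elim simp
    qed
    moreover have "AE \<omega> in M. continuous_on UNIV (\<Psi> \<omega>) \<and> \<Psi> \<omega> 0 = 0"
      using \<Psi> unfolding cond_log_char_def by blast
    ultimately show ?thesis
      by eventually_elim (use continuous_log_unique[OF _ _ \<Phi>_cont \<Phi>_0] in blast)
  qed
  show ?thesis
    using exists unique unfolding F_def Y_def \<Phi>_def[abs_def] by blast
qed

end
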